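(* Let $(J_n)_{n\ge 0}$ be the Jacobsthal numbers and, for $n\ge 0$, let $$HSJ_n=\begin{bmatrix} J_n+jJ_{n+3}\\ -J_{n+1}+jJ_{n+2}\end{bmatrix}.$$ Then: (1) for all integers $n\ge 0$ and $t\ge 0$, $\displaystyle\sum_{s=0}^{t} HSJ_{n+s}=\frac12\left(HSJ_{n+t+2}-HSJ_{n+1}\right)$; (2) for all integers $n\ge 1$, $\displaystyle\sum_{s=1}^{n} HSJ_{s}=\frac12\left(HSJ_{n+2}-HSJ_{2}\right)$.
   Context: The Jacobsthal numbers are defined by $J_0=0$, $J_1=1$, $J_{n+2}=J_{n+1}+2J_n$. Here $j$ is the hyperbolic unit ($j^2=1$, $j\neq\pm1$); spinors are column vectors with two hyperbolic-number entries, added and multiplied by real scalars componentwise. *)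

theory Defs
  imports "HOL-Analysis.Analysis"
begin

fun jacobsthal :: "nat \<Rightarrow> nat" where
  "jacobsthal 0 = 0"
| "jacobsthal (Suc 0) = 1"
| "jacobsthal (Suc (Suc n)) = jacobsthal (Suc n) + 2 * jacobsthal n"

text \<open>\<open>Hyperbolic a b\<close> stands for the hyperbolic (split-complex) number \<open>a + j b\<close>, where \<open>j\<^sup>2 = 1\<close>.\<close>

datatype hyperbolic = Hyperbolic (hre: real) (him: real)

instantiation hyperbolic :: comm_ring_1
begin

definition zero_hyperbolic :: hyperbolic
  where "0 = Hyperbolic 0 0"

definition one_hyperbolic :: hyperbolic
  where "1 = Hyperbolic 1 0"

definition plus_hyperbolic :: "hyperbolic \<Rightarrow> hyperbolic \<Rightarrow> hyperbolic"
  where "x + y = Hyperbolic (hre x + hre y) (him x + him y)"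

definition uminus_hyperbolic :: "hyperbolic \<Rightarrow> hyperbolic"
  where "- x = Hyperbolic (- hre x) (- him x)"

definition minus_hyperbolic :: "hyperbolic \<Rightarrow> hyperbolic \<Rightarrow> hyperbolic"
  where "x - y = Hyperbolic (hre x - hre y) (him x - him y)"

definition times_hyperbolic :: "hyperbolic \<Rightarrow> hyperbolic \<Rightarrow> hyperbolic"
  where "x * y = Hyperbolic (hre x * hre y + him x * him y) (hre x * him y + him x * hre y)"

instance
  by standard
    (auto simp: zero_hyperbolic_def one_hyperbolic_def plus_hyperbolic_def uminus_hyperbolic_def
      minus_hyperbolic_def times_hyperbolic_def algebra_simps)

end

instantiation hyperbolic :: real_algebra_1
begin

definition scaleR_hyperbolic :: "real \<Rightarrow> hyperbolic \<Rightarrow> hyperbolic"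
  where "r *\<^sub>R x = Hyperbolic (r * hre x) (r * him x)"

instance
  by standard
    (auto simp: scaleR_hyperbolic_def plus_hyperbolic_def times_hyperbolic_def algebra_simps)

end

definition hyp_j :: hyperbolic
  where "hyp_j = Hyperbolic 0 1"

lemma hyp_j_square: "hyp_j\<^sup>2 = 1"
  by (simp add: power2_eq_square hyp_j_def times_hyperbolic_def one_hyperbolic_def)

lemma hyp_j_neq: "hyp_j \<noteq> 1" "hyp_j \<noteq> - 1"
  by (simp_all add: hyp_j_def one_hyperbolic_def uminus_hyperbolic_def)

lemma Hyperbolic_eq: "Hyperbolic a b = of_real a + hyp_j * of_real b"
  by (simp add: hyp_j_def of_real_def scaleR_hyperbolic_def one_hyperbolic_def
      plus_hyperbolic_def times_hyperbolic_def)

type_synonym hyp_spinor = "hyperbolic ^ 2"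

definition HSJ :: "nat \<Rightarrow> hyp_spinor"
  where "HSJ n = vector
    [of_nat (jacobsthal n) + hyp_j * of_nat (jacobsthal (n + 3)),
     - of_nat (jacobsthal (n + 1)) + hyp_j * of_nat (jacobsthal (n + 2))]"

end

theory Submission
  imports Defs
begin

lemma scaleR_sum_of_linear_recurrence:
  fixes f :: "nat \<Rightarrow> 'a::real_vector"
  assumes recurrence: "\<And>k. f (Suc (Suc k)) = f (Suc k) + c *\<^sub>R f k"
    and "m \<le> Suc n"
  shows "c *\<^sub>R sum f {m..n} = f (Suc (Suc n)) - f (Suc m)"
proof -
  have "c *\<^sub>R sum f {m..n} = (\<Sum>k = m..n. f (Suc (Suc k)) - f (Suc k))"
    by (simp add: recurrence scaleR_sum_right)
  also have "\<dots> = f (Suc (Suc n)) - f (Suc m)"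
    using \<open>m \<le> Suc n\<close> by (rule sum_Suc_diff)
  finally show ?thesis .
qed

lemma of_nat_jacobsthal_Suc_Suc:
  "(of_nat (jacobsthal (Suc (Suc n))) :: 'a::real_algebra_1) =
    of_nat (jacobsthal (Suc n)) + 2 *\<^sub>R of_nat (jacobsthal n)"
  by (simp add: scaleR_conv_of_real)

lemma HSJ_Suc_Suc: "HSJ (Suc (Suc n)) = HSJ (Suc n) + 2 *\<^sub>R HSJ n"
  by (simp add: HSJ_def vec_eq_iff forall_2 of_nat_jacobsthal_Suc_Suc numeral_3_eq_3
      scaleR_add_right scaleR_diff_right distrib_left del: jacobsthal.simps)

lemma sum_HSJ:
  assumes "m \<le> Suc n"
  shows "sum HSJ {m..n} = (1 / 2) *\<^sub>R (HSJ (n + 2) - HSJ (m + 1))"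
  using scaleR_sum_of_linear_recurrence[where f = HSJ, OF HSJ_Suc_Suc assms]
  by (simp add: eq_vector_fraction_iff)

theorem theorem3p4:
  "(\<forall>n t :: nat. (\<Sum>s = 0..t. HSJ (n + s)) = (1 / 2 :: real) *\<^sub>R (HSJ (n + t + 2) - HSJ (n + 1))) \<and>
   (\<forall>n :: nat. n \<ge> 1 \<longrightarrow> (\<Sum>s = 1..n. HSJ s) = (1 / 2 :: real) *\<^sub>R (HSJ (n + 2) - HSJ 2))"
proof (intro conjI allI impI)
  fix n t :: nat
  have "(\<Sum>s = 0..t. HSJ (n + s)) = sum HSJ {n..n + t}"
    using sum.atLeastAtMost_shift_0[of n "n + t" HSJ] by simp
  also have "\<dots> = (1 / 2) *\<^sub>R (HSJ (n + t + 2) - HSJ (n + 1))"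
    by (rule sum_HSJ) simp
  finally show "(\<Sum>s = 0..t. HSJ (n + s)) = (1 / 2 :: real) *\<^sub>R (HSJ (n + t + 2) - HSJ (n + 1))" .
next
  fix n :: nat
  show "(\<Sum>s = 1..n. HSJ s) = (1 / 2 :: real) *\<^sub>R (HSJ (n + 2) - HSJ 2)"
    using sum_HSJ[of 1 n] by (simp add: numeral_2_eq_2)
qed

end
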